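(* For every integer $k\ge 1$, the sum $a_k=\sum_\mu a_k(\mu)$ (over all integer partitions $\mu$) is the number of symmetric $(k,k)$-connecting set partitions of $[2k]$.
   Context: $[k]=\{1,2,\dots,k\}$. Integer partitions are identified with their Young diagrams and ordered by containment; $\emptyset$ is the only partition of $0$. A limiting vacillating tableau of shape $\mu$ and length $2k$ is a sequence of integer partitions $(\mu^{(0)}=\emptyset,\mu^{(1/2)},\mu^{(1)},\dots,\mu^{(k-1/2)},\mu^{(k)}=\mu)$ such that for each integer $j=0,\dots,k-1$: (a) $\mu^{(j)}\supseteq\mu^{(j+1/2)}$ and $|\mu^{(j)}/\mu^{(j+1/2)}|\in\{0,1\}$; (b) $\mu^{(j+1/2)}\subseteq\mu^{(j+1)}$ and $|\mu^{(j+1)}/\mu^{(j+1/2)}|=1$. $a_k(\mu)$ is the number of limiting vacillating tableaux of shape $\mu$ and length $2k$. A set partition of $[2k]$ is symmetric if it is invariant under the map $i\mapsto 2k+1-i$ (the image of each block is a block). It is $(k,k)$-connecting if every block $X$ satisfies $\min X\le k<\max X$. *)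

theory Defs
  imports "HOL-Library.Disjoint_Sets" "HOL-Analysis.Infinite_Sum"
begin

text \<open>An integer partition is the list of its parts, so that the empty list is the only
  partition of 0.\<close>

definition int_partition :: "nat list \<Rightarrow> bool" where
  "int_partition \<mu> \<longleftrightarrow> sorted_wrt (\<ge>) \<mu> \<and> (\<forall>p \<in> set \<mu>. 0 < p)"

definition young_diagram :: "nat list \<Rightarrow> (nat \<times> nat) set" where
  "young_diagram \<mu> = {(i, j). i < length \<mu> \<and> j < \<mu> ! i}"

text \<open>Half-integer indices are doubled: entry \<open>i\<close> of the list \<open>T\<close> is the partition with
  index \<open>i/2\<close>.\<close>

definition limiting_vacillating_tableau :: "nat \<Rightarrow> nat list \<Rightarrow> nat list list \<Rightarrow> bool" where
  "limiting_vacillating_tableau k \<mu> T \<longleftrightarrow>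
     length T = 2 * k + 1 \<and>
     (\<forall>\<nu> \<in> set T. int_partition \<nu>) \<and>
     T ! 0 = [] \<and> T ! (2 * k) = \<mu> \<and>
     (\<forall>j < k.
        young_diagram (T ! (2 * j + 1)) \<subseteq> young_diagram (T ! (2 * j)) \<and>
        card (young_diagram (T ! (2 * j)) - young_diagram (T ! (2 * j + 1))) \<in> {0, 1} \<and>
        young_diagram (T ! (2 * j + 1)) \<subseteq> young_diagram (T ! (2 * j + 2)) \<and>
        card (young_diagram (T ! (2 * j + 2)) - young_diagram (T ! (2 * j + 1))) = 1)"

definition num_lvt :: "nat \<Rightarrow> nat list \<Rightarrow> nat" where
  "num_lvt k \<mu> = card {T. limiting_vacillating_tableau k \<mu> T}"

definition symmetric_partition :: "nat \<Rightarrow> nat set set \<Rightarrow> bool" where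
  "symmetric_partition k P \<longleftrightarrow> (\<forall>X \<in> P. (\<lambda>i. 2 * k + 1 - i) ` X \<in> P)"

definition connecting_partition :: "nat \<Rightarrow> nat set set \<Rightarrow> bool" where
  "connecting_partition k P \<longleftrightarrow> (\<forall>X \<in> P. Min X \<le> k \<and> k < Max X)"

end

theory Submission
  imports Defs "HOL-Combinatorics.Stirling"
begin

text \<open>Both sides equal \<open>\<Sum>j\<le>k. S(k, j) * t(j)\<close>, where \<open>S\<close> denotes the Stirling numbers of the second
  kind and \<open>t(j)\<close> is the number of involutions of a \<open>j\<close>-element set.

  The tableaux. Write \<open>U\<close> and \<open>D\<close> for the operators on formal sums of partitions that add,
  respectively remove, one cell in all possible ways. The tableaux of length \<open>2k\<close> are counted by
  \<open>(U (1 + D))\<^sup>k\<close> applied to the empty partition. Young's lattice is a differential poset,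
  \<open>D U - U D = 1\<close> (lemma \<open>sum_down_up\<close>). Consequently the number \<open>f(\<nu>)\<close> of saturated chains from the
  empty partition to \<open>\<nu>\<close>, which is the number of standard Young tableaux of shape \<open>\<nu>\<close>, satisfies
  \<open>\<Sum>\<mu>. f(\<mu>) = (|\<nu>| + 1) f(\<nu>)\<close>, the sum being over the upper covers \<open>\<mu>\<close> of \<open>\<nu>\<close>
  (lemma \<open>sum_num_chains_up\<close>). With this identity the recursion for the tableaux turns into the
  recursion for the Stirling numbers, and \<open>a\<^sub>k(\<mu>) = S(k, |\<mu>|) f(\<mu>)\<close> follows by induction on \<open>k\<close>
  (lemma \<open>num_lvt_eq\<close>). Every partition has one more upper cover than lower covers, so the sum of
  \<open>f\<close> over the partitions of \<open>n\<close> satisfies the recursion \<open>t(n + 2) = t(n + 1) + (n + 1) t(n)\<close> of the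
  telephone numbers (lemma \<open>sum_num_chains\<close>). Summing over \<open>\<mu>\<close> gives the first half.

  The set partitions. Every block of a connecting partition meets both halves of \<open>[2k]\<close>, so the
  partition amounts to a partition of each half together with a bijection between their blocks.
  Symmetry makes the upper partition the mirror image of the lower one, and turns the bijection into
  an involution on the blocks of a partition of \<open>[k]\<close> (lemma \<open>bij_betw_symmetric_connecting\<close>).
  There are \<open>S(k, j)\<close> partitions of \<open>[k]\<close> with \<open>j\<close> blocks, each carrying \<open>t(j)\<close> involutions.\<close>

section \<open>Young's lattice as a differential poset\<close>

text \<open>Order ideals in place of lists of parts turn the meets and joins of Young's lattice into
  intersections and unions.\<close>

definition diagram :: "(nat \<times> nat) set \<Rightarrow> bool" where
  "diagram S \<longleftrightarrow> finite S \<and> (\<forall>i j i' j'. (i, j) \<in> S \<longrightarrow> i' \<le> i \<longrightarrow> j' \<le> j \<longrightarrow> (i', j') \<in> S)"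

definition up :: "(nat \<times> nat) set \<Rightarrow> (nat \<times> nat) set set" where
  "up S = {T. diagram T \<and> S \<subseteq> T \<and> card T = Suc (card S)}"

definition down :: "(nat \<times> nat) set \<Rightarrow> (nat \<times> nat) set set" where
  "down S = {T. diagram T \<and> T \<subseteq> S \<and> card S = Suc (card T)}"

definition row :: "(nat \<times> nat) set \<Rightarrow> nat \<Rightarrow> nat" where
  "row S i = card {j. (i, j) \<in> S}"

lemma diagram_finite: "diagram S \<Longrightarrow> finite S"
  and diagramD: "diagram S \<Longrightarrow> (i, j) \<in> S \<Longrightarrow> i' \<le> i \<Longrightarrow> j' \<le> j \<Longrightarrow> (i', j') \<in> S"
  by (auto simp: diagram_def)

lemma diagram_empty [simp]: "diagram {}"
  by (simp add: diagram_def)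

lemma diagram_Un: "diagram S \<Longrightarrow> diagram T \<Longrightarrow> diagram (S \<union> T)"
  and diagram_Int: "diagram S \<Longrightarrow> diagram T \<Longrightarrow> diagram (S \<inter> T)"
  unfolding diagram_def by blast+

lemma in_down_iff_in_up: "diagram S \<Longrightarrow> diagram T \<Longrightarrow> T \<in> down S \<longleftrightarrow> S \<in> up T"
  by (auto simp: up_def down_def)

lemma finite_initial_segment:
  fixes A :: "nat set"
  assumes "finite A" and "\<And>x y. x \<in> A \<Longrightarrow> y \<le> x \<Longrightarrow> y \<in> A"
  shows "A = {..<card A}"
proof -
  have "\<exists>m. m \<notin> A" using assms(1) ex_new_if_finite infinite_UNIV_nat by blast
  define m where "m = (LEAST m. m \<notin> A)"
  have "m \<notin> A" unfolding m_def using \<open>\<exists>m. m \<notin> A\<close> by (rule LeastI_ex)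
  moreover have "x \<in> A" if "x < m" for x
    using that not_less_Least unfolding m_def by blast
  ultimately have "A = {..<m}"
    using assms(2) by (force simp: not_less[symmetric])
  then show ?thesis by simp
qed

lemma mem_diagram_iff:
  assumes "diagram S"
  shows "(i, j) \<in> S \<longleftrightarrow> j < row S i"
proof -
  have "finite {j. (i, j) \<in> S}"
    by (rule finite_subset[of _ "snd ` S"]) (use assms in \<open>force simp: diagram_def\<close>)+
  then have "{j. (i, j) \<in> S} = {..<row S i}"
    unfolding row_def by (rule finite_initial_segment) (use assms diagramD in auto)
  then show ?thesis by auto
qed

lemma row_antimono: "diagram S \<Longrightarrow> i \<le> i' \<Longrightarrow> row S i' \<le> row S i"
  by (metis diagramD linorder_not_less mem_diagram_iff order_refl)

text \<open>Outer corners: adding a cell has to keep the rows contiguous and their lengths weakly decreasing,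
  and the only inequality that can break is the one with the preceding row.\<close>

lemma diagram_insert_iff:
  assumes S: "diagram S" and new: "(i, j) \<notin> S"
  shows "diagram (insert (i, j) S) \<longleftrightarrow> j = row S i \<and> (i = 0 \<or> row S i < row S (i - 1))"
proof
  assume D: "diagram (insert (i, j) S)"
  have ge: "row S i \<le> j" using new mem_diagram_iff[OF S] by auto
  have "\<not> row S i < j"
  proof
    assume "row S i < j"
    then have "(i, row S i) \<in> S" using diagramD[OF D, of i j i "row S i"] by auto
    then show False using mem_diagram_iff[OF S] by auto
  qed
  then have j: "j = row S i" using ge by simp
  have "row S i < row S (i - 1)" if "i \<noteq> 0"
  proof -
    have "(i - 1, j) \<in> S" using diagramD[OF D, of i j "i - 1" j] that by auto
    then show ?thesis using mem_diagram_iff[OF S] j by auto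
  qed
  then show "j = row S i \<and> (i = 0 \<or> row S i < row S (i - 1))" using j by blast
next
  assume R: "j = row S i \<and> (i = 0 \<or> row S i < row S (i - 1))"
  have "(i', j') \<in> insert (i, j) S" if "i' \<le> i" "j' \<le> j" for i' j'
  proof (cases "i' = i")
    case True
    then show ?thesis using that R mem_diagram_iff[OF S, of i j'] by auto
  next
    case False
    then have "row S (i - 1) \<le> row S i'" using that by (intro row_antimono[OF S]) auto
    then show ?thesis using that R False mem_diagram_iff[OF S, of i' j'] by auto
  qed
  then show "diagram (insert (i, j) S)"
    using S unfolding diagram_def by auto
qed

text \<open>Inner corners, dually: removing a cell can break only the inequality with the following row.\<close>

lemma diagram_remove_iff:
  assumes S: "diagram S" and old: "(i, j) \<in> S"
  shows "diagram (S - {(i, j)}) \<longleftrightarrow> Suc j = row S i \<and> row S (Suc i) < row S i"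
proof
  assume D: "diagram (S - {(i, j)})"
  have lt: "j < row S i" using old mem_diagram_iff[OF S] by auto
  have "(i, Suc j) \<notin> S" using diagramD[OF D, of i "Suc j" i j] by auto
  then have j: "Suc j = row S i" using mem_diagram_iff[OF S] lt by auto
  have "(Suc i, j) \<notin> S" using diagramD[OF D, of "Suc i" j i j] by auto
  then show "Suc j = row S i \<and> row S (Suc i) < row S i"
    using mem_diagram_iff[OF S] j by auto
next
  assume R: "Suc j = row S i \<and> row S (Suc i) < row S i"
  have "(i', j') = (i, j)" if "(i', j') \<in> S" "i \<le> i'" "j \<le> j'" for i' j'
  proof (cases "i' = i")
    case True
    then show ?thesis using that R mem_diagram_iff[OF S, of i j'] by auto
  next
    case False
    then have "row S i' \<le> row S (Suc i)" using that by (intro row_antimono[OF S]) auto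
    then show ?thesis using that R mem_diagram_iff[OF S, of i' j'] by auto
  qed
  then show "diagram (S - {(i, j)})"
    using S unfolding diagram_def by blast
qed

lemma up_eq:
  assumes S: "diagram S"
  shows "up S = (\<lambda>i. insert (i, row S i) S) ` {i. i = 0 \<or> row S i < row S (i - 1)}"
proof safe
  fix T assume T: "T \<in> up S"
  then have "card (T - S) = 1"
    using diagram_finite[OF S] by (auto simp: up_def card_Diff_subset)
  then obtain i j where ij: "T - S = {(i, j)}" by (auto simp: card_1_singleton_iff)
  then have TS: "T = insert (i, j) S" "(i, j) \<notin> S" using T by (auto simp: up_def)
  then show "T \<in> (\<lambda>i. insert (i, row S i) S) ` {i. i = 0 \<or> row S i < row S (i - 1)}"
    using T diagram_insert_iff[OF S TS(2)] by (auto simp: up_def)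
qed (use S diagram_insert_iff[OF S] mem_diagram_iff[OF S] diagram_finite[OF S] in \<open>auto simp: up_def\<close>)

lemma down_eq:
  assumes S: "diagram S"
  shows "down S = (\<lambda>i. S - {(i, row S i - 1)}) ` {i. row S (Suc i) < row S i}"
proof safe
  fix T assume T: "T \<in> down S"
  then have "card (S - T) = 1"
    by (auto simp: down_def card_Diff_subset diagram_finite)
  then obtain i j where ij: "S - T = {(i, j)}" by (auto simp: card_1_singleton_iff)
  then have TS: "T = S - {(i, j)}" "(i, j) \<in> S" using T by (auto simp: down_def)
  then show "T \<in> (\<lambda>i. S - {(i, row S i - 1)}) ` {i. row S (Suc i) < row S i}"
    using T diagram_remove_iff[OF S TS(2)]
    by (auto simp: down_def intro!: image_eqI[of _ _ i])
next
  fix i assume i: "row S (Suc i) < row S i"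
  then have in_S: "(i, row S i - 1) \<in> S" using mem_diagram_iff[OF S] by auto
  then have "card S > 0" using diagram_finite[OF S] card_gt_0_iff by blast
  then show "S - {(i, row S i - 1)} \<in> down S"
    using i in_S diagram_remove_iff[OF S in_S] diagram_finite[OF S]
    by (auto simp: down_def card_Diff_singleton)
qed

lemma finite_down: "diagram S \<Longrightarrow> finite (down S)"
  by (rule finite_subset[of _ "Pow S"]) (auto simp: down_def diagram_finite)

text \<open>A row \<open>i\<close> that is longer than its successor accounts for one removable cell, in row \<open>i\<close>, and for one
  addable cell, in row \<open>i + 1\<close>. Row 0 can always be extended, and this is the one extra upper cover.\<close>

lemma card_up:
  assumes S: "diagram S"
  shows "finite (up S)" "card (up S) = Suc (card (down S))"
proof -
  let ?R = "{i. row S (Suc i) < row S i}"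
  have "inj_on (\<lambda>i. insert (i, row S i) S) {i. i = 0 \<or> row S i < row S (i - 1)}"
    using mem_diagram_iff[OF S] by (auto intro!: inj_onI)
  moreover have rows: "{i. i = 0 \<or> row S i < row S (i - 1)} = insert 0 (Suc ` ?R)"
  proof -
    have "i \<in> insert 0 (Suc ` ?R)" if "i = 0 \<or> row S i < row S (i - 1)" for i
      using that by (cases i) auto
    then show ?thesis by auto
  qed
  ultimately have up: "card (up S) = card (insert 0 (Suc ` ?R))"
    unfolding up_eq[OF S] by (simp only: card_image)
  have inj: "inj_on (\<lambda>i. S - {(i, row S i - 1)}) ?R"
  proof (rule inj_onI)
    fix i i' assume i: "i \<in> ?R" and "S - {(i, row S i - 1)} = S - {(i', row S i' - 1)}"
    moreover have "(i, row S i - 1) \<in> S" using i mem_diagram_iff[OF S] by auto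
    ultimately show "i = i'" by blast
  qed
  then have fin: "finite ?R"
    by (rule finite_imageD[rotated]) (use finite_down[OF S] down_eq[OF S] in simp)
  then show "finite (up S)" unfolding up_eq[OF S] rows by simp
  have "card (insert 0 (Suc ` ?R)) = Suc (card ?R)"
    using fin by (subst card_insert_disjoint) (auto simp: card_image)
  then show "card (up S) = Suc (card (down S))"
    using up down_eq[OF S] inj by (simp add: card_image)
qed

text \<open>Two different diagrams of equal size have a common upper cover iff they have a common lower cover,
  and these covers are their union and their intersection. This is modularity of Young's lattice,
  and it makes the off-diagonal terms of \<open>D U\<close> and \<open>U D\<close> agree.\<close>

lemma mem_up_down_iff:
  assumes S: "diagram S" and R: "diagram R" and "R \<noteq> S"
  shows "T \<in> up S \<and> R \<in> down T \<longleftrightarrow> T = S \<union> R \<and> S \<inter> R \<in> down S \<and> R \<in> up (S \<inter> R)"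
proof -
  note fin = diagram_finite[OF S] diagram_finite[OF R]
  have sizes: "card (S \<union> R) + card (S \<inter> R) = card S + card R"
    using card_Un_Int[OF fin] by simp
  show ?thesis
  proof
    assume L: "T \<in> up S \<and> R \<in> down T"
    then have T: "diagram T" "S \<subseteq> T" "R \<subseteq> T" "card T = Suc (card S)" "card R = card S"
      by (auto simp: up_def down_def)
    have "S \<union> R \<noteq> S"
      using \<open>R \<noteq> S\<close> T(5) fin card_subset_eq by blast
    then have "card S < card (S \<union> R)"
      using fin by (intro psubset_card_mono) auto
    then have eq: "S \<union> R = T"
      using T by (intro card_seteq) (auto simp: diagram_finite)
    then show "T = S \<union> R \<and> S \<inter> R \<in> down S \<and> R \<in> up (S \<inter> R)"
      using sizes T R diagram_Int[OF S R] by (auto simp: up_def down_def)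
  next
    assume Q: "T = S \<union> R \<and> S \<inter> R \<in> down S \<and> R \<in> up (S \<inter> R)"
    then have "card S = Suc (card (S \<inter> R))" "card R = Suc (card (S \<inter> R))"
      by (auto simp: up_def down_def)
    then show "T \<in> up S \<and> R \<in> down T"
      using sizes Q R diagram_Un[OF S R] by (auto simp: up_def down_def)
  qed
qed

text \<open>The relation \<open>D U = 1 + U D\<close>, paired with an arbitrary function \<open>g\<close>. The terms with \<open>R = S\<close> contribute
  the numbers of upper and of lower covers of \<open>S\<close>, which differ by one; the terms with \<open>R \<noteq> S\<close> on
  both sides match by exchanging \<open>S \<union> R\<close> and \<open>S \<inter> R\<close>.\<close>

lemma sum_down_up:
  fixes g :: "(nat \<times> nat) set \<Rightarrow> nat"
  assumes S: "diagram S"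
  shows "(\<Sum>T\<in>up S. \<Sum>R\<in>down T. g R) = g S + (\<Sum>T\<in>down S. \<Sum>R\<in>up T. g R)"
proof -
  have split_up: "(\<Sum>R\<in>down T. g R) = g S + (\<Sum>R\<in>down T - {S}. g R)" if "T \<in> up S" for T
    using that S finite_down[of T] by (intro sum.remove) (auto simp: up_def down_def)
  have split_down: "(\<Sum>R\<in>up T. g R) = g S + (\<Sum>R\<in>up T - {S}. g R)" if "T \<in> down S" for T
    using that S card_up(1)[of T] by (intro sum.remove) (auto simp: up_def down_def)
  have "(\<Sum>T\<in>up S. \<Sum>R\<in>down T - {S}. g R) = (\<Sum>(T, R)\<in>(SIGMA T:up S. down T - {S}). g R)"
    using card_up(1)[OF S] by (intro sum.Sigma) (auto simp: up_def intro!: finite_down)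
  also have "\<dots> = (\<Sum>(T, R)\<in>(SIGMA T:down S. up T - {S}). g R)"
  proof -
    have from_above: "T = S \<union> R \<and> S \<inter> R \<in> down S \<and> R \<in> up (S \<inter> R)"
      if "T \<in> up S" "R \<in> down T" "R \<noteq> S" for T R
      using that mem_up_down_iff[OF S, of R T] by (auto simp: down_def)
    have from_below: "T = S \<inter> R \<and> S \<union> R \<in> up S \<and> R \<in> down (S \<union> R)"
      if TR: "T \<in> down S" "R \<in> up T" "R \<noteq> S" for T R
    proof -
      have R: "diagram R" "card R = card S" "T \<subseteq> S \<inter> R" "card S = Suc (card T)"
        using TR by (auto simp: up_def down_def)
      have "S \<inter> R \<noteq> S"
        using \<open>R \<noteq> S\<close> R S diagram_finite card_subset_eq by (metis Int_lower2)
      then have "card (S \<inter> R) < card S"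
        using diagram_finite[OF S] by (intro psubset_card_mono) auto
      then have "T = S \<inter> R"
        using R diagram_finite[OF S] by (intro card_seteq) auto
      then show ?thesis
        using mem_up_down_iff[OF S R(1) \<open>R \<noteq> S\<close>] TR by auto
    qed
    show ?thesis
      by (rule sum.reindex_bij_witness[where i = "\<lambda>(T, R). (S \<union> R, R)" and j = "\<lambda>(T, R). (S \<inter> R, R)"])
         (auto dest: from_above from_below)
  qed
  also have "\<dots> = (\<Sum>T\<in>down S. \<Sum>R\<in>up T - {S}. g R)"
    using finite_down[OF S] card_up(1) by (intro sum.Sigma[symmetric]) (auto simp: down_def)
  finally have rest: "(\<Sum>T\<in>up S. \<Sum>R\<in>down T - {S}. g R) = (\<Sum>T\<in>down S. \<Sum>R\<in>up T - {S}. g R)" .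
  have "(\<Sum>T\<in>up S. \<Sum>R\<in>down T. g R) = card (up S) * g S + (\<Sum>T\<in>up S. \<Sum>R\<in>down T - {S}. g R)"
    by (simp add: split_up sum.distrib)
  also have "\<dots> = g S + (card (down S) * g S + (\<Sum>T\<in>down S. \<Sum>R\<in>up T - {S}. g R))"
    by (simp add: card_up(2)[OF S] rest)
  also have "card (down S) * g S + (\<Sum>T\<in>down S. \<Sum>R\<in>up T - {S}. g R) = (\<Sum>T\<in>down S. \<Sum>R\<in>up T. g R)"
    by (simp add: split_down sum.distrib)
  finally show ?thesis .
qed

text \<open>The number of saturated chains of length \<open>n\<close> from the empty diagram to \<open>S\<close>. For \<open>n = card S\<close>
  this is the number of standard Young tableaux of shape \<open>S\<close>; for any other \<open>n\<close> it is 0.\<close>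

fun num_chains :: "nat \<Rightarrow> (nat \<times> nat) set \<Rightarrow> nat" where
  "num_chains 0 S = (if S = {} then 1 else 0)"
| "num_chains (Suc n) S = (\<Sum>T\<in>down S. num_chains n T)"

text \<open>In operator form this reads \<open>D U\<^bsup>n+1\<^esup> {} = (n + 1) U\<^sup>n {}\<close>, as if \<open>D\<close> were the derivative with respect to
  \<open>U\<close>: pulling \<open>D\<close> through each \<open>U\<close> contributes one summand, and \<open>D {} = 0\<close>.\<close>

lemma sum_num_chains_up:
  assumes "diagram S"
  shows "(\<Sum>T\<in>up S. num_chains (Suc n) T) = Suc n * num_chains n S"
  using assms
proof (induction n arbitrary: S)
  case 0
  have "(\<Sum>T\<in>down S. \<Sum>R\<in>up T. num_chains 0 R) = 0"
    by (intro sum.neutral ballI) (auto simp: up_def)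
  then show ?case
    using sum_down_up[OF 0, of "num_chains 0"] by simp
next
  case (Suc n)
  have "(\<Sum>T\<in>up S. num_chains (Suc (Suc n)) T)
      = num_chains (Suc n) S + (\<Sum>T\<in>down S. \<Sum>R\<in>up T. num_chains (Suc n) R)"
    using sum_down_up[OF Suc.prems, of "num_chains (Suc n)"] by simp
  also have "(\<Sum>T\<in>down S. \<Sum>R\<in>up T. num_chains (Suc n) R) = (\<Sum>T\<in>down S. Suc n * num_chains n T)"
    by (intro sum.cong refl Suc.IH) (simp add: down_def)
  also have "\<dots> = Suc n * num_chains (Suc n) S"
    by (simp add: sum_distrib_left)
  finally show ?case by simp
qed

definition diagrams_of_size :: "nat \<Rightarrow> (nat \<times> nat) set set" where
  "diagrams_of_size n = {S. diagram S \<and> card S = n}"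

lemma finite_diagrams_of_size: "finite (diagrams_of_size n)"
proof (rule finite_subset)
  have "i < n \<and> j < n" if "S \<in> diagrams_of_size n" "(i, j) \<in> S" for S i j
  proof -
    have "(\<lambda>i'. (i', j)) ` {..i} \<subseteq> S" "Pair i ` {..j} \<subseteq> S"
      using that by (auto simp: diagrams_of_size_def dest: diagramD)
    then have "card ((\<lambda>i'. (i', j)) ` {..i}) \<le> n" "card (Pair i ` {..j}) \<le> n"
      using that by (auto simp: diagrams_of_size_def diagram_finite intro!: card_mono)
    then show ?thesis
      by (auto simp: card_image inj_on_def)
  qed
  then show "diagrams_of_size n \<subseteq> Pow ({..<n} \<times> {..<n})"
    by fast
qed auto

lemma sum_down_eq_sum_up:
  fixes h :: "(nat \<times> nat) set \<Rightarrow> (nat \<times> nat) set \<Rightarrow> nat"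
  shows "(\<Sum>T\<in>diagrams_of_size (Suc n). \<Sum>S\<in>down T. h S T) = (\<Sum>S\<in>diagrams_of_size n. \<Sum>T\<in>up S. h S T)"
proof -
  have "(\<Sum>T\<in>diagrams_of_size (Suc n). \<Sum>S\<in>down T. h S T)
      = (\<Sum>T\<in>diagrams_of_size (Suc n). \<Sum>S | S \<in> diagrams_of_size n \<and> S \<subseteq> T. h S T)"
    by (intro sum.cong) (auto simp: diagrams_of_size_def down_def)
  also have "\<dots> = (\<Sum>S\<in>diagrams_of_size n. \<Sum>T | T \<in> diagrams_of_size (Suc n) \<and> S \<subseteq> T. h S T)"
    using finite_diagrams_of_size by (rule sum.swap_restrict) (rule finite_diagrams_of_size)
  also have "\<dots> = (\<Sum>S\<in>diagrams_of_size n. \<Sum>T\<in>up S. h S T)"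
    by (intro sum.cong) (auto simp: diagrams_of_size_def up_def)
  finally show ?thesis .
qed

text \<open>The number of involutions of an \<open>n\<close>-element set: the last element is fixed or is exchanged with one
  of the others.\<close>

fun telephone :: "nat \<Rightarrow> nat" where
  "telephone 0 = 1"
| "telephone (Suc 0) = 1"
| "telephone (Suc (Suc n)) = telephone (Suc n) + Suc n * telephone n"

text \<open>This is the sum of \<open>f(\<lambda>)\<close> over the partitions \<open>\<lambda>\<close> of \<open>n\<close>. A chain of length \<open>n + 1\<close> extends a
  chain ending in some \<open>S\<close> of size \<open>n\<close> by one of the upper covers of \<open>S\<close>. One of these covers leaves
  a sum of the same kind for \<open>n\<close>; the others are as many as the lower covers of \<open>S\<close>, and exchanging
  the order of summation reduces their contribution to \<open>sum_num_chains_up\<close>.\<close>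

lemma sum_num_chains:
  "(\<Sum>S\<in>diagrams_of_size n. num_chains n S) = telephone n"
proof (induction n rule: telephone.induct)
  case 1
  have "diagrams_of_size 0 = {{}}"
    by (auto simp: diagrams_of_size_def diagram_finite)
  then show ?case by simp
next
  have step: "(\<Sum>S\<in>diagrams_of_size (Suc n). num_chains (Suc n) S)
      = (\<Sum>S\<in>diagrams_of_size n. num_chains n S) + (\<Sum>S\<in>diagrams_of_size n. \<Sum>T\<in>down S. num_chains n S)" for n
  proof -
    have "(\<Sum>S\<in>diagrams_of_size (Suc n). num_chains (Suc n) S)
        = (\<Sum>S\<in>diagrams_of_size n. \<Sum>T\<in>up S. num_chains n S)"
      using sum_down_eq_sum_up[of "\<lambda>S T. num_chains n S"] by simp
    also have "\<dots> = (\<Sum>S\<in>diagrams_of_size n. num_chains n S + (\<Sum>T\<in>down S. num_chains n S))"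
      by (intro sum.cong) (auto simp: diagrams_of_size_def card_up)
    finally show ?thesis by (simp add: sum.distrib)
  qed
  {
    case 2
    have "diagrams_of_size 0 = {{}}"
      by (auto simp: diagrams_of_size_def diagram_finite)
    then show ?case using step[of 0] by (simp add: down_def del: num_chains.simps) simp
  next
    case (3 n)
    have "(\<Sum>S\<in>diagrams_of_size (Suc n). \<Sum>T\<in>down S. num_chains (Suc n) S)
        = (\<Sum>S\<in>diagrams_of_size n. \<Sum>T\<in>up S. num_chains (Suc n) T)"
      by (rule sum_down_eq_sum_up)
    also have "\<dots> = (\<Sum>S\<in>diagrams_of_size n. Suc n * num_chains n S)"
      by (intro sum.cong refl sum_num_chains_up) (simp add: diagrams_of_size_def)
    also have "\<dots> = Suc n * telephone n"
      using 3 by (simp only: sum_distrib_left[symmetric])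
    finally show ?case using step[of "Suc n"] 3 by simp
  }
qed

section \<open>Counting limiting vacillating tableaux\<close>

lemma mem_young_diagram: "(i, j) \<in> young_diagram \<mu> \<longleftrightarrow> i < length \<mu> \<and> j < \<mu> ! i"
  by (simp add: young_diagram_def)

lemma diagram_young_diagram:
  assumes "int_partition \<mu>"
  shows "diagram (young_diagram \<mu>)"
proof -
  have "young_diagram \<mu> = (SIGMA i:{..<length \<mu>}. {..<\<mu> ! i})"
    by (auto simp: mem_young_diagram)
  then have "finite (young_diagram \<mu>)" by simp
  moreover have "\<mu> ! i \<le> \<mu> ! i'" if "i' \<le> i" "i < length \<mu>" for i i'
    using assms that sorted_wrt_nth_less[of "(\<ge>)" \<mu> i' i] by (cases "i' = i") (auto simp: int_partition_def)
  ultimately show ?thesis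
    unfolding diagram_def mem_young_diagram by (meson le_less_trans less_le_trans)
qed

lemma young_diagram_eq_iff:
  assumes "int_partition \<mu>" "int_partition \<nu>"
  shows "young_diagram \<mu> = young_diagram \<nu> \<longleftrightarrow> \<mu> = \<nu>"
proof
  assume eq: "young_diagram \<mu> = young_diagram \<nu>"
  have iff: "i < length \<mu> \<and> j < \<mu> ! i \<longleftrightarrow> i < length \<nu> \<and> j < \<nu> ! i" for i j
    using eq by (metis mem_young_diagram)
  have "i < length \<mu> \<longleftrightarrow> i < length \<nu>" for i
    using iff[of i 0] assms unfolding int_partition_def by (metis nth_mem)
  then have len: "length \<mu> = length \<nu>"
    by (metis linorder_neqE_nat less_irrefl)
  then show "\<mu> = \<nu>"
  proof (rule nth_equalityI)
    fix i assume "i < length \<mu>"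
    then have "j < \<mu> ! i \<longleftrightarrow> j < \<nu> ! i" for j
      using iff[of i j] len by simp
    then show "\<mu> ! i = \<nu> ! i"
      by (metis linorder_neqE_nat less_irrefl)
  qed
qed simp

text \<open>The parts are the nonempty rows. They form an initial segment of the rows because the first column
  of an order ideal does.\<close>

lemma diagram_imp_young_diagram:
  assumes S: "diagram S"
  obtains \<mu> where "int_partition \<mu>" "young_diagram \<mu> = S"
proof
  define n where "n = card {i. (i, 0) \<in> S}"
  have "finite {i. (i, 0) \<in> S}"
    by (rule finite_subset[of _ "fst ` S"]) (use S in \<open>force simp: diagram_def\<close>)+
  then have "{i. (i, 0) \<in> S} = {..<n}"
    unfolding n_def by (rule finite_initial_segment) (use S diagramD in auto)
  then have n: "i < n \<longleftrightarrow> 0 < row S i" for i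
    using mem_diagram_iff[OF S, of i 0] by (metis lessThan_iff mem_Collect_eq)
  let ?\<mu> = "map (row S) [0..<n]"
  have "sorted_wrt (\<ge>) ?\<mu>"
    using row_antimono[OF S] by (simp add: sorted_wrt_iff_nth_less)
  then show "int_partition ?\<mu>"
    using n by (auto simp: int_partition_def)
  have "(i, j) \<in> young_diagram ?\<mu> \<longleftrightarrow> (i, j) \<in> S" for i j
    using n[of i] by (auto simp: mem_young_diagram mem_diagram_iff[OF S])
  then show "young_diagram ?\<mu> = S" by auto
qed

lemma bij_betw_young_diagram:
  assumes "X \<subseteq> {S. diagram S}"
  shows "bij_betw young_diagram {\<mu>. int_partition \<mu> \<and> young_diagram \<mu> \<in> X} X"
  unfolding bij_betw_def
proof
  show "inj_on young_diagram {\<mu>. int_partition \<mu> \<and> young_diagram \<mu> \<in> X}"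
    by (auto intro!: inj_onI simp: young_diagram_eq_iff)
  show "young_diagram ` {\<mu>. int_partition \<mu> \<and> young_diagram \<mu> \<in> X} = X"
  proof safe
    fix S assume "S \<in> X"
    then obtain \<mu> where "int_partition \<mu>" "young_diagram \<mu> = S"
      using assms diagram_imp_young_diagram by blast
    then show "S \<in> young_diagram ` {\<mu>. int_partition \<mu> \<and> young_diagram \<mu> \<in> X}"
      using \<open>S \<in> X\<close> by blast
  qed
qed

definition ups :: "nat list \<Rightarrow> nat list set" where
  "ups \<nu> = {\<mu>. int_partition \<mu> \<and> young_diagram \<mu> \<in> up (young_diagram \<nu>)}"

definition downs :: "nat list \<Rightarrow> nat list set" where
  "downs \<mu> = {\<nu>. int_partition \<nu> \<and> young_diagram \<nu> \<in> down (young_diagram \<mu>)}"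

lemma bij_betw_ups: "bij_betw young_diagram (ups \<nu>) (up (young_diagram \<nu>))"
  unfolding ups_def by (rule bij_betw_young_diagram) (auto simp: up_def)

lemma bij_betw_downs: "bij_betw young_diagram (downs \<mu>) (down (young_diagram \<mu>))"
  unfolding downs_def by (rule bij_betw_young_diagram) (auto simp: down_def)

lemma finite_ups: "int_partition \<nu> \<Longrightarrow> finite (ups \<nu>)"
  and finite_downs: "int_partition \<nu> \<Longrightarrow> finite (downs \<nu>)"
  using bij_betw_finite[OF bij_betw_ups] bij_betw_finite[OF bij_betw_downs]
  by (auto simp: card_up finite_down diagram_young_diagram)

lemma add_one_cell_iff:
  assumes "int_partition \<mu>" "int_partition \<nu>"
  shows "young_diagram \<nu> \<subseteq> young_diagram \<mu> \<and> card (young_diagram \<mu> - young_diagram \<nu>) = 1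
    \<longleftrightarrow> \<nu> \<in> downs \<mu>"
  using assms[THEN diagram_young_diagram] assms diagram_finite
    card_mono[of "young_diagram \<mu>" "young_diagram \<nu>"]
  by (auto simp: downs_def down_def card_Diff_subset)

lemma remove_at_most_one_cell_iff:
  assumes "int_partition \<mu>" "int_partition \<nu>"
  shows "young_diagram \<nu> \<subseteq> young_diagram \<mu> \<and> card (young_diagram \<mu> - young_diagram \<nu>) \<in> {0, 1}
    \<longleftrightarrow> \<mu> \<in> insert \<nu> (ups \<nu>)"
proof -
  have "finite (young_diagram \<mu> - young_diagram \<nu>)"
    using assms diagram_young_diagram diagram_finite by auto
  then have "young_diagram \<nu> \<subseteq> young_diagram \<mu> \<and> card (young_diagram \<mu> - young_diagram \<nu>) = 0
      \<longleftrightarrow> \<mu> = \<nu>"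
    using young_diagram_eq_iff[OF assms] by auto
  moreover have "\<nu> \<in> downs \<mu> \<longleftrightarrow> \<mu> \<in> ups \<nu>"
    using assms[THEN diagram_young_diagram] assms by (auto simp: ups_def downs_def in_down_iff_in_up)
  ultimately show ?thesis
    using add_one_cell_iff[OF assms] by auto
qed

text \<open>The last two entries of a tableau are peeled off. The half step either leaves the preceding shape
  \<open>\<kappa>\<close> unchanged or removes one cell from it, hence \<open>\<kappa> = \<nu>\<close> or \<open>\<kappa>\<close> is an upper cover of \<open>\<nu>\<close>.\<close>

lemma limiting_vacillating_tableau_Suc_iff:
  assumes \<mu>: "int_partition \<mu>"
  shows "limiting_vacillating_tableau (Suc k) \<mu> T \<longleftrightarrow>
    (\<exists>\<nu> T'. T = T' @ [\<nu>, \<mu>] \<and> \<nu> \<in> downs \<mu> \<and>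
      (\<exists>\<kappa> \<in> insert \<nu> (ups \<nu>). limiting_vacillating_tableau k \<kappa> T'))"
    (is "?L \<longleftrightarrow> ?R")
proof
  assume L: ?L
  then have len: "length T = 2 * k + 3"
    by (simp add: limiting_vacillating_tableau_def)
  let ?\<nu> = "T ! (2 * k + 1)" and ?\<kappa> = "T ! (2 * k)" and ?T' = "take (2 * k + 1) T"
  have T: "T = ?T' @ [?\<nu>, \<mu>]"
  proof -
    have "drop (2 * k + 1) T = [T ! (2 * k + 1), T ! (2 * k + 2)]"
      using len by (simp add: Cons_nth_drop_Suc[symmetric])
    then show ?thesis
      using L append_take_drop_id[of "2 * k + 1" T] by (simp add: limiting_vacillating_tableau_def)
  qed
  have ip: "int_partition ?\<nu>" "int_partition ?\<kappa>"
    using L len by (auto simp: limiting_vacillating_tableau_def)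
  have "?\<nu> \<in> downs \<mu>"
    using L add_one_cell_iff[OF \<mu> ip(1)] by (auto simp: limiting_vacillating_tableau_def)
  moreover have "?\<kappa> \<in> insert ?\<nu> (ups ?\<nu>)"
    unfolding remove_at_most_one_cell_iff[OF ip(2,1), symmetric]
    using L by (simp add: limiting_vacillating_tableau_def)
  moreover have "limiting_vacillating_tableau k ?\<kappa> ?T'"
    using L len set_take_subset[of "2 * k + 1" T] by (auto simp: limiting_vacillating_tableau_def)
  ultimately show ?R using T by blast
next
  assume ?R
  then obtain \<nu> T' \<kappa> where T: "T = T' @ [\<nu>, \<mu>]" and \<nu>: "\<nu> \<in> downs \<mu>"
    and \<kappa>: "\<kappa> \<in> insert \<nu> (ups \<nu>)" and T': "limiting_vacillating_tableau k \<kappa> T'"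
    by blast
  have ip: "int_partition \<nu>" "int_partition \<kappa>"
    using \<nu> \<kappa> by (auto simp: downs_def ups_def)
  have len: "length T' = 2 * k + 1" and "T' ! (2 * k) = \<kappa>"
    using T' by (auto simp: limiting_vacillating_tableau_def)
  then have nths: "T ! (2 * k) = \<kappa>" "T ! (2 * k + 1) = \<nu>" "T ! (2 * k + 2) = \<mu>"
    "\<And>i. i < 2 * k + 1 \<Longrightarrow> T ! i = T' ! i"
    by (auto simp: T nth_append)
  have last: "young_diagram \<nu> \<subseteq> young_diagram \<kappa>" "card (young_diagram \<kappa> - young_diagram \<nu>) \<in> {0, 1}"
    "young_diagram \<nu> \<subseteq> young_diagram \<mu>" "card (young_diagram \<mu> - young_diagram \<nu>) = 1"
    using add_one_cell_iff[OF \<mu> ip(1)] \<nu> remove_at_most_one_cell_iff[OF ip(2,1)] \<kappa> by blast+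
  have "young_diagram (T ! (2 * j + 1)) \<subseteq> young_diagram (T ! (2 * j)) \<and>
        card (young_diagram (T ! (2 * j)) - young_diagram (T ! (2 * j + 1))) \<in> {0, 1} \<and>
        young_diagram (T ! (2 * j + 1)) \<subseteq> young_diagram (T ! (2 * j + 2)) \<and>
        card (young_diagram (T ! (2 * j + 2)) - young_diagram (T ! (2 * j + 1))) = 1"
    if "j < Suc k" for j
  proof (cases "j = k")
    case True
    then show ?thesis using last nths by simp
  next
    case False
    then show ?thesis
      using that T' by (auto simp: nths limiting_vacillating_tableau_def)
  qed
  moreover have "T ! 0 = []"
    using nths(4)[of 0] T' by (simp add: limiting_vacillating_tableau_def)
  moreover have "\<forall>\<nu> \<in> set T. int_partition \<nu>"
    using T T' ip \<mu> by (auto simp: limiting_vacillating_tableau_def)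
  ultimately show ?L
    using len nths(3) unfolding limiting_vacillating_tableau_def by (simp add: T)
qed

lemma limiting_vacillating_tableaux_0:
  "{T. limiting_vacillating_tableau 0 \<mu> T} = (if \<mu> = [] then {[[]]} else {})"
  by (auto simp: limiting_vacillating_tableau_def length_Suc_conv int_partition_def)

text \<open>The transfer operator \<open>U (1 + D)\<close> in terms of counts. The shorter tableau determines its last shape
  \<open>\<kappa>\<close>, so different \<open>\<kappa>\<close> give disjoint families. Finiteness has to be proved along with the count,
  since an infinite family would have cardinality 0.\<close>

lemma num_lvt_Suc:
  assumes \<mu>: "int_partition \<mu>"
    and fin: "\<And>\<kappa>. int_partition \<kappa> \<Longrightarrow> finite {T. limiting_vacillating_tableau k \<kappa> T}"
  shows "finite {T. limiting_vacillating_tableau (Suc k) \<mu> T}"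
    and "num_lvt (Suc k) \<mu> = (\<Sum>\<nu>\<in>downs \<mu>. num_lvt k \<nu> + (\<Sum>\<kappa>\<in>ups \<nu>. num_lvt k \<kappa>))"
proof -
  define prefixes where
    "prefixes \<nu> = (\<Union>\<kappa>\<in>insert \<nu> (ups \<nu>). {T. limiting_vacillating_tableau k \<kappa> T})" for \<nu>
  have eq: "{T. limiting_vacillating_tableau (Suc k) \<mu> T}
      = (\<lambda>(\<nu>, T'). T' @ [\<nu>, \<mu>]) ` (SIGMA \<nu>:downs \<mu>. prefixes \<nu>)"
    unfolding limiting_vacillating_tableau_Suc_iff[OF \<mu>] prefixes_def by force
  have fins: "finite (insert \<nu> (ups \<nu>))"
    "\<forall>\<kappa>\<in>insert \<nu> (ups \<nu>). finite {T. limiting_vacillating_tableau k \<kappa> T}" if "\<nu> \<in> downs \<mu>" for \<nu>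
    using that fin finite_ups by (auto simp: downs_def ups_def)
  have fin_prefixes: "\<forall>\<nu>\<in>downs \<mu>. finite (prefixes \<nu>)"
    unfolding prefixes_def using fins by blast
  show "finite {T. limiting_vacillating_tableau (Suc k) \<mu> T}"
    unfolding eq using fin_prefixes finite_downs[OF \<mu>] by (intro finite_imageI finite_SigmaI) auto
  have "num_lvt (Suc k) \<mu> = card (SIGMA \<nu>:downs \<mu>. prefixes \<nu>)"
    unfolding num_lvt_def eq by (rule card_image) (auto intro!: inj_onI)
  also have "\<dots> = (\<Sum>\<nu>\<in>downs \<mu>. card (prefixes \<nu>))"
    using fin_prefixes finite_downs[OF \<mu>] by (rule card_SigmaI[rotated])
  also have "\<dots> = (\<Sum>\<nu>\<in>downs \<mu>. num_lvt k \<nu> + (\<Sum>\<kappa>\<in>ups \<nu>. num_lvt k \<kappa>))"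
  proof (rule sum.cong[OF refl])
    fix \<nu> assume \<nu>: "\<nu> \<in> downs \<mu>"
    have "card (prefixes \<nu>) = (\<Sum>\<kappa>\<in>insert \<nu> (ups \<nu>). num_lvt k \<kappa>)"
      unfolding prefixes_def num_lvt_def
      by (rule card_UN_disjoint[OF fins[OF \<nu>]]) (auto simp: limiting_vacillating_tableau_def)
    also have "\<dots> = num_lvt k \<nu> + (\<Sum>\<kappa>\<in>ups \<nu>. num_lvt k \<kappa>)"
      using fins(1)[OF \<nu>] by (subst sum.insert) (auto simp: ups_def up_def)
    finally show "card (prefixes \<nu>) = num_lvt k \<nu> + (\<Sum>\<kappa>\<in>ups \<nu>. num_lvt k \<kappa>)" .
  qed
  finally show "num_lvt (Suc k) \<mu> = (\<Sum>\<nu>\<in>downs \<mu>. num_lvt k \<nu> + (\<Sum>\<kappa>\<in>ups \<nu>. num_lvt k \<kappa>))" .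
qed

text \<open>The closed form \<open>S(k, |\<mu>|) f(\<mu>)\<close> of \<open>a\<^sub>k(\<mu>)\<close>, as a function of the diagram.\<close>

definition weighted_chains :: "nat \<Rightarrow> (nat \<times> nat) set \<Rightarrow> nat" where
  "weighted_chains k S = Stirling k (card S) * num_chains (card S) S"

text \<open>If \<open>\<nu>\<close> has size \<open>m\<close>, the shapes that may precede it contribute \<open>S(k, m) f(\<nu>)\<close> for \<open>\<nu>\<close> itself and
  \<open>S(k, m + 1) (m + 1) f(\<nu>)\<close> for its upper covers, together \<open>S(k + 1, m + 1) f(\<nu>)\<close>. Summing over the lower
  covers \<open>\<nu>\<close> of \<open>\<mu>\<close> turns \<open>f(\<nu>)\<close> into \<open>f(\<mu>)\<close>.\<close>

lemma num_lvt_eq: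
  assumes "int_partition \<mu>"
  shows "finite {T. limiting_vacillating_tableau k \<mu> T}"
    and "num_lvt k \<mu> = weighted_chains k (young_diagram \<mu>)"
  using assms
proof (induction k arbitrary: \<mu>)
  case 0
  have "Stirling 0 n = (if n = 0 then 1 else 0)" for n
    by (cases n) auto
  {
    case 1
    show ?case by (simp add: limiting_vacillating_tableaux_0)
  next
    case 2
    then show ?case
      using young_diagram_eq_iff[OF 2, of "[]"] diagram_finite[OF diagram_young_diagram[OF 2]]
        \<open>Stirling 0 (card (young_diagram \<mu>)) = _\<close>
      by (auto simp: num_lvt_def limiting_vacillating_tableaux_0 weighted_chains_def
          int_partition_def young_diagram_def)
  }
next
  case (Suc k)
  {
    case 1
    then show ?case using num_lvt_Suc(1) Suc.IH(1) by blast
  next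
    case 2
    have down: "num_lvt k \<nu> + (\<Sum>\<kappa>\<in>ups \<nu>. num_lvt k \<kappa>)
        = Stirling (Suc k) (card (young_diagram \<mu>)) * num_chains (card (young_diagram \<nu>)) (young_diagram \<nu>)"
      if "\<nu> \<in> downs \<mu>" for \<nu>
    proof -
      let ?S = "young_diagram \<nu>"
      have \<nu>: "int_partition \<nu>" "card (young_diagram \<mu>) = Suc (card ?S)"
        using that by (auto simp: downs_def down_def)
      have "(\<Sum>\<kappa>\<in>ups \<nu>. num_lvt k \<kappa>) = (\<Sum>\<kappa>\<in>ups \<nu>. weighted_chains k (young_diagram \<kappa>))"
        by (intro sum.cong refl Suc.IH(2)) (simp add: ups_def)
      also have "\<dots> = (\<Sum>T\<in>up ?S. weighted_chains k T)"
        by (rule sum.reindex_bij_betw[OF bij_betw_ups])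
      also have "\<dots> = (\<Sum>T\<in>up ?S. Stirling k (Suc (card ?S)) * num_chains (Suc (card ?S)) T)"
        by (intro sum.cong) (auto simp: weighted_chains_def up_def)
      also have "\<dots> = Stirling k (Suc (card ?S)) * (Suc (card ?S) * num_chains (card ?S) ?S)"
        using sum_num_chains_up[OF diagram_young_diagram[OF \<nu>(1)]]
        by (simp only: sum_distrib_left[symmetric])
      finally show ?thesis
        using Suc.IH(2)[OF \<nu>(1)] \<nu>(2) by (simp add: weighted_chains_def algebra_simps)
    qed
    let ?n = "card (young_diagram \<mu>)"
    have "num_lvt (Suc k) \<mu> = (\<Sum>\<nu>\<in>downs \<mu>. num_lvt k \<nu> + (\<Sum>\<kappa>\<in>ups \<nu>. num_lvt k \<kappa>))"
      by (rule num_lvt_Suc(2)[OF 2 Suc.IH(1)])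
    also have "\<dots> = (\<Sum>\<nu>\<in>downs \<mu>. Stirling (Suc k) ?n * num_chains (card (young_diagram \<nu>)) (young_diagram \<nu>))"
      by (rule sum.cong[OF refl down])
    also have "\<dots> = (\<Sum>T\<in>down (young_diagram \<mu>). Stirling (Suc k) ?n * num_chains (card T) T)"
      by (rule sum.reindex_bij_betw[OF bij_betw_downs])
    also have "\<dots> = weighted_chains (Suc k) (young_diagram \<mu>)"
    proof (cases ?n)
      case 0
      then show ?thesis by (simp add: weighted_chains_def down_def)
    next
      case (Suc m)
      have "(\<Sum>T\<in>down (young_diagram \<mu>). num_chains (card T) T)
          = (\<Sum>T\<in>down (young_diagram \<mu>). num_chains m T)"
        using Suc by (intro sum.cong) (auto simp: down_def)
      then show ?thesis
        using Suc by (simp add: weighted_chains_def sum_distrib_left[symmetric] del: Stirling.simps)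
    qed
    finally show ?case .
  }
qed

text \<open>Shapes with more than \<open>k\<close> cells contribute nothing because \<open>S(k, n) = 0\<close> for \<open>n > k\<close>, so the sum is
  finite and can be grouped by size.\<close>

lemma has_sum_num_lvt:
  "(num_lvt k has_sum (\<Sum>n\<le>k. Stirling k n * telephone n)) {\<mu>. int_partition \<mu>}"
proof -
  let ?D = "\<Union>n\<le>k. diagrams_of_size n"
  have "(\<Sum>S\<in>?D. weighted_chains k S) = (\<Sum>n\<le>k. \<Sum>S\<in>diagrams_of_size n. weighted_chains k S)"
    by (rule sum.UNION_disjoint)
       (use finite_diagrams_of_size in \<open>auto simp: diagrams_of_size_def\<close>)
  also have "\<dots> = (\<Sum>n\<le>k. Stirling k n * (\<Sum>S\<in>diagrams_of_size n. num_chains n S))"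
    unfolding sum_distrib_left
    by (intro sum.cong) (auto simp: weighted_chains_def diagrams_of_size_def)
  also have "\<dots> = (\<Sum>n\<le>k. Stirling k n * telephone n)"
    by (simp only: sum_num_chains)
  finally have "(weighted_chains k has_sum (\<Sum>n\<le>k. Stirling k n * telephone n)) ?D"
    using has_sum_finite[of ?D "weighted_chains k"] finite_diagrams_of_size by simp
  also have "?this \<longleftrightarrow> (weighted_chains k has_sum (\<Sum>n\<le>k. Stirling k n * telephone n)) {S. diagram S}"
    by (rule has_sum_cong_neutral) (auto simp: diagrams_of_size_def weighted_chains_def)
  also have "\<dots> \<longleftrightarrow> ((\<lambda>\<mu>. weighted_chains k (young_diagram \<mu>)) has_sum
      (\<Sum>n\<le>k. Stirling k n * telephone n)) {\<mu>. int_partition \<mu> \<and> young_diagram \<mu> \<in> {S. diagram S}}"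
    by (rule has_sum_reindex_bij_betw[OF bij_betw_young_diagram, symmetric]) simp
  also have "{\<mu>. int_partition \<mu> \<and> young_diagram \<mu> \<in> {S. diagram S}} = {\<mu>. int_partition \<mu>}"
    using diagram_young_diagram by auto
  also have "((\<lambda>\<mu>. weighted_chains k (young_diagram \<mu>)) has_sum
      (\<Sum>n\<le>k. Stirling k n * telephone n)) {\<mu>. int_partition \<mu>} \<longleftrightarrow> ?thesis"
    by (rule has_sum_cong) (simp add: num_lvt_eq(2))
  finally show ?thesis .
qed

section \<open>Set partitions and involutions\<close>

text \<open>The new element \<open>a\<close> joins a block \<open>B\<close> of a partition of \<open>A\<close>, or forms a block of its own. The second
  possibility is encoded by \<open>B = {}\<close>, which is never a block. The inverse deletes \<open>a\<close>, and recovers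
  \<open>B\<close> as the block of \<open>a\<close> without \<open>a\<close>.\<close>

lemma bij_betw_partitions_insert:
  assumes "a \<notin> A"
  shows "bij_betw (\<lambda>(P, B). insert (insert a B) (P - {B}))
    (SIGMA P:{P. partition_on A P}. insert {} P) {Q. partition_on (insert a A) Q}"
proof (rule bij_betw_byWitness[where f' =
    "\<lambda>Q. ((\<lambda>X. X - {a}) ` Q - {{}}, \<Union>{X \<in> Q. a \<in> X} - {a})"])
  have mem: "X \<subseteq> A" "a \<notin> X" "X \<noteq> {}" if "partition_on A P" "X \<in> P" for P X
    using that assms by (auto simp: partition_on_def)
  have left: "((\<lambda>X. X - {a}) ` insert (insert a B) (P - {B}) - {{}},
      \<Union>{X \<in> insert (insert a B) (P - {B}). a \<in> X} - {a}) = (P, B)"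
    if P: "partition_on A P" "B \<in> insert {} P" for P B
  proof -
    let ?Q = "insert (insert a B) (P - {B})"
    have a: "a \<notin> B" using P mem(2) by auto
    have "(\<lambda>X. X - {a}) ` (P - {B}) = P - {B}"
      using mem(2)[OF P(1)] by (auto simp: image_iff)
    then have "(\<lambda>X. X - {a}) ` ?Q - {{}} = P"
      using P a mem(3)[OF P(1)] by auto
    moreover have "{X \<in> ?Q. a \<in> X} = {insert a B}"
      using P mem(2)[OF P(1)] by auto
    ultimately show ?thesis
      using a by simp
  qed
  show "\<forall>z\<in>SIGMA P:{P. partition_on A P}. insert {} P.
      ((\<lambda>X. X - {a}) ` (case z of (P, B) \<Rightarrow> insert (insert a B) (P - {B})) - {{}},
       \<Union>{X \<in> case z of (P, B) \<Rightarrow> insert (insert a B) (P - {B}). a \<in> X} - {a}) = z"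
  proof
    fix z assume "z \<in> (SIGMA P:{P. partition_on A P}. insert {} P)"
    then obtain P B where "z = (P, B)" "partition_on A P" "B \<in> insert {} P" by blast
    then show "((\<lambda>X. X - {a}) ` (case z of (P, B) \<Rightarrow> insert (insert a B) (P - {B})) - {{}},
       \<Union>{X \<in> case z of (P, B) \<Rightarrow> insert (insert a B) (P - {B}). a \<in> X} - {a}) = z"
      using left by (simp only: case_prod_conv)
  qed
  have inv: "partition_on A ((\<lambda>X. X - {a}) ` Q - {{}})
      \<and> \<Union>{X \<in> Q. a \<in> X} - {a} \<in> insert {} ((\<lambda>X. X - {a}) ` Q - {{}})
      \<and> insert (insert a (\<Union>{X \<in> Q. a \<in> X} - {a})) (((\<lambda>X. X - {a}) ` Q - {{}}) - {\<Union>{X \<in> Q. a \<in> X} - {a}}) = Q"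
    if Q: "partition_on (insert a A) Q" for Q
  proof -
    obtain X where X: "X \<in> Q" "a \<in> X" using Q by (auto simp: partition_on_def)
    have only: "a \<notin> Y" if "Y \<in> Q" "Y \<noteq> X" for Y
      using that X Q by (auto simp: partition_on_def disjoint_def)
    then have "{X \<in> Q. a \<in> X} = {X}" using X by auto
    then have U: "\<Union>{X \<in> Q. a \<in> X} - {a} = X - {a}" by simp
    have part: "partition_on ((insert a A) - {a}) ((\<lambda>X. X - {a}) ` Q - {{}})"
      using Q by (rule partition_on_transform) (auto simp: disjnt_def)
    have rest: "(\<lambda>X. X - {a}) ` (Q - {X}) = Q - {X}"
      using only by (auto simp: image_iff)
    have "(\<lambda>X. X - {a}) ` Q = insert (X - {a}) (Q - {X})"
      using rest X(1) by (metis image_insert insert_Diff)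
    moreover have "X - {a} \<notin> Q - {X}"
    proof
      assume "X - {a} \<in> Q - {X}"
      then have "(X - {a}) \<inter> X = {}"
        using partition_onD2[OF Q] X(1) by (auto dest: disjointD)
      then have "X - {a} = {}" by blast
      then show False using \<open>X - {a} \<in> Q - {X}\<close> partition_onD3[OF Q] by (metis DiffD1)
    qed
    moreover have "{} \<notin> Q" using Q by (simp add: partition_on_def)
    ultimately have "((\<lambda>X. X - {a}) ` Q - {{}}) - {X - {a}} = Q - {X}" by auto
    then show ?thesis
      using part assms X unfolding U by (auto simp: insert_absorb insert_Diff)
  qed
  then show "\<forall>Q\<in>{Q. partition_on (insert a A) Q}.
      (\<lambda>(P, B). insert (insert a B) (P - {B})) ((\<lambda>X. X - {a}) ` Q - {{}}, \<Union>{X \<in> Q. a \<in> X} - {a}) = Q"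
    by simp
  show "(\<lambda>Q. ((\<lambda>X. X - {a}) ` Q - {{}}, \<Union>{X \<in> Q. a \<in> X} - {a})) ` {Q. partition_on (insert a A) Q}
      \<subseteq> (SIGMA P:{P. partition_on A P}. insert {} P)"
    using inv by auto
  show "(\<lambda>(P, B). insert (insert a B) (P - {B})) ` (SIGMA P:{P. partition_on A P}. insert {} P)
      \<subseteq> {Q. partition_on (insert a A) Q}"
  proof clarify
    fix P B assume P: "partition_on A P" "B \<in> insert {} P"
    then have "partition_on (A - B) (P - {B})"
      using partition_on_insert[of B "P - {B}" A] partition_onD3[OF P(1)] partition_onD2[OF P(1)]
      by (cases "B = {}") (auto simp: insert_absorb disjnt_def disjoint_def)
    moreover have "insert a A - insert a B = A - B" using assms by auto
    moreover have "B \<subseteq> A" using P mem by auto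
    ultimately show "partition_on (insert a A) (insert (insert a B) (P - {B}))"
      using assms by (subst partition_on_insert) (auto simp: partition_on_def disjnt_def)
  qed
qed

text \<open>There are \<open>S(n, j)\<close> partitions of an \<open>n\<close>-element set with \<open>j\<close> blocks. With an arbitrary weight \<open>g\<close> on
  the number of blocks, the induction step is a single application of the hypothesis, to the weight
  \<open>g(j + 1) + j g(j)\<close>.\<close>

lemma sum_partitions_Stirling:
  fixes g :: "nat \<Rightarrow> nat"
  assumes "finite A"
  shows "(\<Sum>P | partition_on A P. g (card P)) = (\<Sum>j\<le>card A. Stirling (card A) j * g j)"
  using assms
proof (induction A arbitrary: g rule: finite_induct)
  case empty
  then show ?case by (simp add: partition_on_empty)
next
  case (insert a A)
  let ?n = "card A"
  have block: "(\<Sum>B\<in>insert {} P. g (card (insert (insert a B) (P - {B})))) = g (Suc (card P)) + card P * g (card P)"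
    if P: "partition_on A P" for P
  proof -
    have fin: "finite P" using finite_elements insert.hyps(1) P by blast
    have new: "insert a B \<notin> P" for B
      using P insert.hyps(2) by (auto simp: partition_on_def)
    have "card (insert (insert a B) (P - {B})) = card P" if "B \<in> P" for B
    proof -
      have "0 < card P" using that fin card_gt_0_iff by blast
      then show ?thesis using that fin new by simp
    qed
    moreover have "{} \<notin> P" using P by (rule partition_onD3)
    ultimately show ?thesis using fin new by simp
  qed
  have "(\<Sum>Q | partition_on (insert a A) Q. g (card Q))
      = (\<Sum>(P, B)\<in>(SIGMA P:{P. partition_on A P}. insert {} P). g (card (insert (insert a B) (P - {B}))))"
    using sum.reindex_bij_betw[OF bij_betw_partitions_insert[OF insert.hyps(2)], of "\<lambda>Q. g (card Q)"]
    by (simp add: case_prod_unfold)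
  also have "\<dots> = (\<Sum>P | partition_on A P. \<Sum>B\<in>insert {} P. g (card (insert (insert a B) (P - {B}))))"
    using finitely_many_partition_on[OF insert.hyps(1)] finite_elements[OF insert.hyps(1)]
    by (intro sum.Sigma[symmetric]) auto
  also have "\<dots> = (\<Sum>P | partition_on A P. g (Suc (card P)) + card P * g (card P))"
    by (intro sum.cong) (auto simp: block simp del: sum.insert)
  also have "\<dots> = (\<Sum>j\<le>?n. Stirling ?n j * (g (Suc j) + j * g j))"
    by (rule insert.IH)
  also have "\<dots> = (\<Sum>j\<le>?n. Stirling ?n j * g (Suc j)) + (\<Sum>j\<le>Suc ?n. Stirling ?n j * (j * g j))"
    by (simp add: distrib_left sum.distrib)
  also have "(\<Sum>j\<le>Suc ?n. Stirling ?n j * (j * g j)) = (\<Sum>j\<le>?n. Stirling ?n (Suc j) * (Suc j * g (Suc j)))"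
    by (subst sum.atMost_Suc_shift) simp
  also have "(\<Sum>j\<le>?n. Stirling ?n j * g (Suc j)) + \<dots> = (\<Sum>j\<le>?n. Stirling (Suc ?n) (Suc j) * g (Suc j))"
    by (simp add: sum.distrib[symmetric] algebra_simps)
  also have "\<dots> = (\<Sum>j\<le>Suc ?n. Stirling (Suc ?n) j * g j)"
    by (subst sum.atMost_Suc_shift) simp
  finally show ?case using insert.hyps by simp
qed

text \<open>The functions are required to be the identity outside \<open>A\<close>, so that an involution of \<open>A\<close> is
  represented by exactly one function.\<close>

definition involutions :: "'a set \<Rightarrow> ('a \<Rightarrow> 'a) set" where
  "involutions A = {f. (\<forall>x. f (f x) = x) \<and> (\<forall>x. x \<notin> A \<longrightarrow> f x = x)}"

text \<open>An involution fixes \<open>a\<close> or exchanges it with some \<open>b\<close>. In the second case what remains is an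
  involution of \<open>A - {b}\<close>.\<close>

lemma involutions_insert:
  assumes "a \<notin> A"
  shows "involutions (insert a A) = involutions A \<union> (\<Union>b\<in>A. (\<lambda>f. f(a := b, b := a)) ` involutions (A - {b}))"
proof safe
  fix f assume f: "f \<in> involutions (insert a A)"
    and no: "f \<notin> (\<Union>b\<in>A. (\<lambda>f. f(a := b, b := a)) ` involutions (A - {b}))"
  have "f a = a"
  proof (rule ccontr)
    assume ne: "f a \<noteq> a"
    \<comment> \<open>making \<open>a\<close> and \<open>f a\<close> fixed points leaves an involution of the other elements\<close>
    let ?b = "f a" and ?g = "f(a := a, f a := f a)"
    have ff: "f (f x) = x" for x using f by (simp add: involutions_def)
    have b: "?b \<in> A" using f ne ff by (auto simp: involutions_def)
    have "f x \<noteq> a" "f x \<noteq> f a" if "x \<noteq> a" "x \<noteq> f a" for x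
      using that ff by metis+
    then have "?g \<in> involutions (A - {?b})"
      using f ne by (auto simp: involutions_def)
    moreover have "f = ?g(a := ?b, ?b := a)"
      using ff ne by (auto simp: fun_eq_iff)
    ultimately show False using no b by blast
  qed
  then show "f \<in> involutions A" using f by (auto simp: involutions_def)
next
  fix f assume "f \<in> involutions A"
  then show "f \<in> involutions (insert a A)" by (auto simp: involutions_def)
next
  fix b f assume b: "b \<in> A" and f: "f \<in> involutions (A - {b})"
  have ff: "f (f x) = x" and outside: "x \<notin> A - {b} \<Longrightarrow> f x = x" for x
    using f by (auto simp: involutions_def)
  have "f a = a" "f b = b" using outside assms by auto
  then have "f x \<noteq> a" "f x \<noteq> b" if "x \<noteq> a" "x \<noteq> b" for x
    using that ff by metis+
  then show "f(a := b, b := a) \<in> involutions (insert a A)"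
    using b assms ff outside by (auto simp: involutions_def)
qed

lemma card_involutions:
  assumes "finite A"
  shows "finite (involutions A) \<and> card (involutions A) = telephone (card A)"
  using assms
proof (induction "card A" arbitrary: A rule: less_induct)
  case less
  show ?case
  proof (cases "A = {}")
    case True
    have "involutions {} = {id :: 'a \<Rightarrow> 'a}" by (auto simp: involutions_def)
    then show ?thesis using True by simp
  next
    case False
    then obtain a C where A: "A = insert a C" "a \<notin> C" by (meson Set.set_insert all_not_in_conv)
    have C: "finite C" "card A = Suc (card C)" using A less.prems by auto
    let ?swap = "\<lambda>b f. f(a := b, b := a)"
    have fixC: "f a = a" if "f \<in> involutions D" "D \<subseteq> C" for f D
      using that A by (auto simp: involutions_def)
    have IH: "finite (involutions C)" "card (involutions C) = telephone (card C)"
      using less.hyps[of C] C by auto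
    have part: "finite (?swap b ` involutions (C - {b}))
        \<and> card (?swap b ` involutions (C - {b})) = telephone (card C - 1)" if b: "b \<in> C" for b
    proof -
      have "inj_on (?swap b) (involutions (C - {b}))"
      proof (rule inj_onI, rule ext)
        fix f g x assume fg: "f \<in> involutions (C - {b})" "g \<in> involutions (C - {b})" "?swap b f = ?swap b g"
        have "f a = a" "g a = a" "f b = b" "g b = b"
          using fg A by (auto simp: involutions_def)
        then show "f x = g x" using fun_cong[OF fg(3), of x] by (auto split: if_splits)
      qed
      moreover have "card (C - {b}) = card C - 1" using b by simp
      ultimately show ?thesis
        using less.hyps[of "C - {b}"] C by (simp add: card_image)
    qed
    have "card (\<Union>b\<in>C. ?swap b ` involutions (C - {b})) = (\<Sum>b\<in>C. card (?swap b ` involutions (C - {b})))"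
    proof (rule card_UN_disjoint)
      show "\<forall>b\<in>C. \<forall>c\<in>C. b \<noteq> c \<longrightarrow> ?swap b ` involutions (C - {b}) \<inter> ?swap c ` involutions (C - {c}) = {}"
        using A by (auto simp: fun_eq_iff) (metis fun_upd_apply)
    qed (use C part in auto)
    also have "\<dots> = card C * telephone (card C - 1)"
      using part by simp
    finally have cardU: "card (\<Union>b\<in>C. ?swap b ` involutions (C - {b})) = card C * telephone (card C - 1)" .
    have "?swap b f a = b" if "b \<in> C" for b f
      using that A by auto
    then have "involutions C \<inter> (\<Union>b\<in>C. ?swap b ` involutions (C - {b})) = {}"
      using fixC[of _ C] A by fastforce
    then have "card (involutions A) = telephone (card C) + card C * telephone (card C - 1)"
      unfolding A involutions_insert[OF A(2)]
      using IH part C cardU by (subst card_Un_disjoint) auto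
    also have "\<dots> = telephone (card A)"
      using C by (cases "card C") auto
    finally show ?thesis
      unfolding A(1) involutions_insert[OF A(2)] using IH part C by auto
  qed
qed

section \<open>Symmetric connecting partitions\<close>

lemma connecting_iff:
  assumes "finite X" "X \<noteq> {}"
  shows "Min X \<le> k \<and> k < Max X \<longleftrightarrow> (\<exists>x\<in>X. x \<le> k) \<and> (\<exists>x\<in>X. k < x)"
  using assms by (simp add: Min_le_iff Max_gr_iff)

definition mirror :: "nat \<Rightarrow> nat \<Rightarrow> nat" where
  "mirror k i = 2 * k + 1 - i"

text \<open>Gluing each block \<open>X\<close> of a partition of \<open>[k]\<close> to the mirror image of \<open>f X\<close> produces blocks that meet
  both halves. The mirror image of the block \<open>X \<union> mirror (f X)\<close> is \<open>f X \<union> mirror X\<close>, which is a block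
  because \<open>f (f X) = X\<close>. Conversely, the lower halves of the blocks of a symmetric connecting partition
  are nonempty and hence form a partition of \<open>[k]\<close>, and \<open>f\<close> sends the lower half of a block to the
  lower half of its mirror image.\<close>

lemma bij_betw_symmetric_connecting:
  "bij_betw (\<lambda>(Q, f). (\<lambda>X. X \<union> mirror k ` f X) ` Q)
    (SIGMA Q:{Q. partition_on {1..k} Q}. involutions Q)
    {P. partition_on {1..2 * k} P \<and> symmetric_partition k P \<and> connecting_partition k P}"
    (is "bij_betw ?\<Phi> ?D ?C")
proof -
  let ?A = "{1..k}" and ?\<rho> = "mirror k"
  have \<rho>\<rho>: "?\<rho> (?\<rho> i) = i" if "i \<in> {1..2 * k}" for i
    using that by (auto simp: mirror_def)
  have \<rho>\<rho>_image: "?\<rho> ` ?\<rho> ` X = X" if "X \<subseteq> {1..2 * k}" for X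
    using that \<rho>\<rho> by (force simp: image_iff)
  have \<rho>_high: "?\<rho> i \<in> {k + 1..2 * k}" if "i \<in> ?A" for i
    using that by (auto simp: mirror_def)
  have \<rho>_low: "?\<rho> i \<in> ?A" if "i \<in> {k + 1..2 * k}" for i
    using that by (auto simp: mirror_def)
  have glue_low: "(X \<union> ?\<rho> ` Y) \<inter> ?A = X" and glue_high: "(X \<union> ?\<rho> ` Y) - ?A = ?\<rho> ` Y"
    if "X \<subseteq> ?A" "Y \<subseteq> ?A" for X Y
    using that \<rho>_high by fastforce+
  have inv_mem: "f X \<in> Q" and inv_inv: "f (f X) = X" if "f \<in> involutions Q" "X \<in> Q" for f Q X
    using that by (auto simp: involutions_def)
  have sub: "X \<subseteq> ?A" if "partition_on ?A Q" "X \<in> Q" for Q X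
    using that by (auto simp: partition_on_def)
  have into: "?\<Phi> (Q, f) \<in> ?C" if Q: "partition_on ?A Q" and f: "f \<in> involutions Q" for Q f
  proof -
    let ?P = "(\<lambda>X. X \<union> ?\<rho> ` f X) ` Q"
    note subs = sub[OF Q] sub[OF Q inv_mem[OF f]]
    have UQ: "\<Union>Q = ?A" and "{} \<notin> Q" using Q by (auto simp: partition_on_def)
    have fQ: "f ` Q = Q"
    proof
      show "f ` Q \<subseteq> Q" using inv_mem[OF f] by blast
      show "Q \<subseteq> f ` Q" using inv_mem[OF f] inv_inv[OF f] by (metis image_eqI subsetI)
    qed
    have "\<Union>?P = \<Union>Q \<union> ?\<rho> ` \<Union>(f ` Q)" by auto
    also have "\<dots> = {1..2 * k}"
    proof -
      have "?\<rho> ` ?A = {k + 1..2 * k}"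
      proof
        show "{k + 1..2 * k} \<subseteq> ?\<rho> ` ?A"
        proof
          fix i assume i: "i \<in> {k + 1..2 * k}"
          then show "i \<in> ?\<rho> ` ?A" using \<rho>_low[OF i] \<rho>\<rho>[of i] by (metis atLeastAtMost_iff image_eqI le_add2 order.trans)
        qed
      qed (use \<rho>_high in blast)
      then show ?thesis unfolding fQ UQ by auto
    qed
    finally have U: "\<Union>?P = {1..2 * k}" .
    have disjnt_glued: "disjnt (X \<union> ?\<rho> ` f X) (Y \<union> ?\<rho> ` f Y)" if XY: "X \<in> Q" "Y \<in> Q" "X \<noteq> Y" for X Y
    proof -
      have disj: "Z \<inter> W = {}" if "Z \<in> Q" "W \<in> Q" "Z \<noteq> W" for Z W
        using that Q by (auto simp: partition_on_def disjoint_def)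
      have "f X \<noteq> f Y" using XY inv_inv[OF f] by metis
      then have "f X \<inter> f Y = {}" using disj inv_mem[OF f] XY by blast
      moreover have "inj_on ?\<rho> ?A" by (auto simp: mirror_def inj_on_def)
      ultimately have "?\<rho> ` f X \<inter> ?\<rho> ` f Y = {}"
        using subs XY by (metis image_empty inj_on_image_Int)
      moreover have "?\<rho> ` f Z \<inter> W = {}" if "Z \<in> Q" "W \<in> Q" for Z W
      proof -
        have "?\<rho> ` f Z \<subseteq> {k + 1..2 * k}" using subs(2)[OF that(1)] \<rho>_high by blast
        moreover have "{k + 1..2 * k} \<inter> ?A = {}" by auto
        ultimately show ?thesis using subs(1)[OF that(2)] by blast
      qed
      ultimately show ?thesis using disj[OF XY] XY unfolding disjnt_def by blast
    qed
    have part: "partition_on {1..2 * k} ?P"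
    proof (rule partition_onI)
      fix p q assume "p \<in> ?P" "q \<in> ?P" "p \<noteq> q"
      then show "disjnt p q" using disjnt_glued by blast
    qed (use U \<open>{} \<notin> Q\<close> in auto)
    have "?\<rho> ` (X \<union> ?\<rho> ` f X) = f X \<union> ?\<rho> ` f (f X)" if "X \<in> Q" for X
    proof -
      have "f X \<subseteq> {1..2 * k}" using subs(2)[OF that] by auto
      then show ?thesis using \<rho>\<rho>_image[of "f X"] inv_inv[OF f that] by (simp add: image_Un Un_commute)
    qed
    then have "symmetric_partition k ?P"
      unfolding symmetric_partition_def using inv_mem[OF f] by (auto simp: mirror_def)
    moreover have "connecting_partition k ?P"
      unfolding connecting_partition_def
    proof
      fix Z assume "Z \<in> ?P"
      then obtain X where X: "X \<in> Q" and Z: "Z = X \<union> ?\<rho> ` f X" by auto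
      obtain x y where xy: "x \<in> X" "y \<in> f X"
        using X inv_mem[OF f X] \<open>{} \<notin> Q\<close> by (metis equals0I)
      have "finite Z" using subs[OF X] Z by (simp add: finite_subset)
      moreover have "x \<in> Z" "x \<le> k" "?\<rho> y \<in> Z" "k < ?\<rho> y"
        using xy Z subs[OF X] \<rho>_high[of y] by auto
      ultimately show "Min Z \<le> k \<and> k < Max Z"
        using connecting_iff[of Z k] by blast
    qed
    ultimately show ?thesis using part by simp
  qed
  have "inj_on ?\<Phi> ?D"
  proof (rule inj_onI, clarify)
    fix Q f Q' f'
    assume Q: "partition_on ?A Q" "f \<in> involutions Q" and Q': "partition_on ?A Q'" "f' \<in> involutions Q'"
      and eq: "(\<lambda>X. X \<union> ?\<rho> ` f X) ` Q = (\<lambda>X. X \<union> ?\<rho> ` f' X) ` Q'"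
    have restrict: "(\<lambda>Z. Z \<inter> ?A) ` (\<lambda>X. X \<union> ?\<rho> ` g X) ` R = R"
      if "partition_on ?A R" "g \<in> involutions R" for R g
    proof -
      have "(X \<union> ?\<rho> ` g X) \<inter> ?A = X" if "X \<in> R" for X
        using that sub[OF \<open>partition_on ?A R\<close>] inv_mem[OF \<open>g \<in> involutions R\<close>] by (intro glue_low) blast+
      then show ?thesis by (simp add: image_image)
    qed
    have QQ': "Q = Q'" using restrict[OF Q] restrict[OF Q'] eq by simp
    have "f X = f' X" for X
    proof (cases "X \<in> Q")
      case True
      then have "X \<union> ?\<rho> ` f X \<in> (\<lambda>X. X \<union> ?\<rho> ` f' X) ` Q'"
        unfolding eq[symmetric] by (rule imageI)
      then obtain Y where Y: "Y \<in> Q'" "X \<union> ?\<rho> ` f X = Y \<union> ?\<rho> ` f' Y"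
        by (elim imageE)
      have X: "X \<subseteq> ?A" "f X \<subseteq> ?A" using True sub[OF Q(1)] inv_mem[OF Q(2)] by auto
      have Y': "Y \<subseteq> ?A" "f' Y \<subseteq> ?A" using Y(1) sub[OF Q'(1)] inv_mem[OF Q'(2)] by auto
      have "X = Y" using glue_low[OF X] glue_low[OF Y'] Y(2) by simp
      have "?\<rho> ` f X = ?\<rho> ` f' Y" using glue_high[OF X] glue_high[OF Y'] Y(2) by simp
      then have "?\<rho> ` ?\<rho> ` f X = ?\<rho> ` ?\<rho> ` f' Y" by simp
      moreover have "f X \<subseteq> {1..2 * k}" "f' Y \<subseteq> {1..2 * k}" using X(2) Y'(2) by auto
      ultimately show ?thesis using \<rho>\<rho>_image \<open>X = Y\<close> by simp
    next
      case False
      then show ?thesis using Q(2) Q'(2) QQ' by (simp add: involutions_def)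
    qed
    then show "Q = Q' \<and> f = f'" using QQ' by auto
  qed
  moreover have "P \<in> ?\<Phi> ` ?D" if P: "P \<in> ?C" for P
  proof -
    have part: "partition_on {1..2 * k} P" using P by simp
    have block: "Y \<subseteq> {1..2 * k}" "Y \<inter> ?A \<noteq> {}" if "Y \<in> P" for Y
    proof -
      show Y: "Y \<subseteq> {1..2 * k}" using part that by (auto simp: partition_on_def)
      have "finite Y" "Y \<noteq> {}" using Y part that finite_subset by (auto simp: partition_on_def)
      then have "\<exists>x\<in>Y. x \<le> k"
        using connecting_iff[of Y k] P that by (auto simp: connecting_partition_def)
      then obtain x where x: "x \<in> Y" "x \<le> k" by blast
      then have "x \<in> {1..2 * k}" using Y by blast
      then have "x \<in> Y \<inter> ?A" using x by simp
      then show "Y \<inter> ?A \<noteq> {}" by blast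
    qed
    have mirror_block: "?\<rho> ` Y \<in> P" if "Y \<in> P" for Y
      using P that by (simp add: symmetric_partition_def mirror_def)
    have same: "Y = Z" if "Y \<in> P" "Z \<in> P" "Y \<inter> ?A = Z \<inter> ?A" for Y Z
    proof -
      have "Y \<inter> Z \<noteq> {}" using that block(2)[of Y] by blast
      then show ?thesis using disjointD[OF partition_onD2[OF part]] that by blast
    qed
    let ?Q = "(\<lambda>Y. Y \<inter> ?A) ` P"
    \<comment> \<open>a block is determined by its lower half, since blocks are disjoint and lower halves nonempty\<close>
    define block_of where "block_of X = (THE Y. Y \<in> P \<and> Y \<inter> ?A = X)" for X
    define f where "f X = (if X \<in> ?Q then ?\<rho> ` block_of X \<inter> ?A else X)" for X
    have block_of: "block_of (Y \<inter> ?A) = Y" if "Y \<in> P" for Y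
      unfolding block_of_def by (rule the_equality) (use that same in auto)
    have f: "f (Y \<inter> ?A) = ?\<rho> ` Y \<inter> ?A" if "Y \<in> P" for Y
      using that block_of[OF that] by (auto simp: f_def)
    have "?A \<inter> {1..2 * k} = ?A" by auto
    then have "partition_on ?A ((\<inter>) ?A ` P - {{}})"
      using partition_on_restrict[OF part, of ?A] by simp
    moreover have "(\<inter>) ?A ` P - {{}} = ?Q" using block(2) by (auto simp: Int_commute)
    ultimately have Q: "partition_on ?A ?Q" by simp
    have "f (f X) = X" for X
    proof (cases "X \<in> ?Q")
      case True
      then obtain Y where Y: "Y \<in> P" "X = Y \<inter> ?A" by blast
      then show ?thesis using f[OF mirror_block[OF Y(1)]] f[OF Y(1)] \<rho>\<rho>_image[OF block(1)[OF Y(1)]] by simp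
    qed (simp add: f_def)
    then have "f \<in> involutions ?Q" by (auto simp: involutions_def f_def)
    moreover have "Y \<inter> ?A \<union> ?\<rho> ` f (Y \<inter> ?A) = Y" if Y: "Y \<in> P" for Y
    proof -
      have "?\<rho> ` (?\<rho> ` Y \<inter> ?A) = Y - ?A"
      proof safe
        fix i assume i: "i \<in> Y" "?\<rho> i \<in> ?A"
        then have "i \<in> {1..2 * k}" using block(1)[OF Y] by blast
        then show "?\<rho> (?\<rho> i) \<in> Y" using \<rho>\<rho> i by simp
        assume "?\<rho> (?\<rho> i) \<in> ?A"
        then show False using \<rho>_high[OF i(2)] by auto
      next
        fix i assume i: "i \<in> Y" "i \<notin> ?A"
        then have hi: "i \<in> {k + 1..2 * k}" "i \<in> {1..2 * k}" using block(1)[OF Y] by force+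
        show "i \<in> ?\<rho> ` (?\<rho> ` Y \<inter> ?A)"
          using \<rho>\<rho>[OF hi(2)] \<rho>_low[OF hi(1)] i(1) by (metis IntI image_eqI)
      qed
      then show ?thesis using f[OF Y] by auto
    qed
    then have "?\<Phi> (?Q, f) = P" by (simp add: image_image)
    ultimately show ?thesis using Q by (intro image_eqI[of _ _ "(?Q, f)"]) auto
  qed
  moreover have "?\<Phi> ` ?D \<subseteq> ?C"
  proof (rule image_subsetI)
    fix z assume "z \<in> ?D"
    then obtain Q f where "z = (Q, f)" "partition_on ?A Q" "f \<in> involutions Q" by blast
    then show "?\<Phi> z \<in> ?C" using into by blast
  qed
  ultimately show ?thesis
    unfolding bij_betw_def by blast
qed

lemma card_symmetric_connecting:
  "card {P. partition_on {1..2 * k} P \<and> symmetric_partition k P \<and> connecting_partition k P}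
    = (\<Sum>j\<le>k. Stirling k j * telephone j)"
proof -
  have inv: "finite (involutions Q) \<and> card (involutions Q) = telephone (card Q)"
    if "partition_on {1..k} Q" for Q
    using that finite_elements by (intro card_involutions) blast
  have "card {P. partition_on {1..2 * k} P \<and> symmetric_partition k P \<and> connecting_partition k P}
      = card (SIGMA Q:{Q. partition_on {1..k} Q}. involutions Q)"
    using bij_betw_same_card[OF bij_betw_symmetric_connecting] by simp
  also have "\<dots> = (\<Sum>Q | partition_on {1..k} Q. card (involutions Q))"
    using inv by (intro card_SigmaI finitely_many_partition_on) auto
  also have "\<dots> = (\<Sum>Q | partition_on {1..k} Q. telephone (card Q))"
    using inv by (intro sum.cong) auto
  also have "\<dots> = (\<Sum>j\<le>k. Stirling k j * telephone j)"
    using sum_partitions_Stirling[of "{1..k}" telephone] by simp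
  finally show ?thesis .
qed

theorem corollary16:
  fixes k :: nat
  assumes "k \<ge> 1"
  shows "(num_lvt k has_sum
           card {P. partition_on {1..2 * k} P \<and> symmetric_partition k P \<and> connecting_partition k P})
         {\<mu>. int_partition \<mu>}"
  unfolding card_symmetric_connecting by (rule has_sum_num_lvt)

end
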